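(* Let $n\ge2$, $s\in(1/2,1)$ and $x\in\mathbb{R}^n$. Assume that $\phi:\mathbb{R}^n\to\mathbb{R}$ is bounded, $\phi\in C^{1,1}(x)$, and $\phi$ is radial and radially nonincreasing, i.e. $\phi(z)=\tilde\Phi(|z|)$ for all $z\in\mathbb{R}^n$, where $\tilde\Phi:[0,\infty)\to\mathbb{R}$ is nonincreasing. Then $$\Delta^s_\infty\phi(x)=-(-\partial^2_{rr})^s\Phi(|x|),$$ where $\Phi$ is the even extension of $\tilde\Phi$ to $\mathbb{R}$: $\Phi(r)=\tilde\Phi(r)$ and $\Phi(-r)=\Phi(r)$ for $r\in[0,\infty)$.
   Context: $C_s=\frac{4^s s\,\Gamma(\frac12+s)}{\pi^{1/2}\Gamma(1-s)}$. $\phi\in C^{1,1}(x)$ means there are $p_x\in\mathbb{R}^n$ and $C_x,\eta_x>0$ such that $|\phi(x+y)-\phi(x)-p_x\cdot y|\le C_x|y|^2$ for all $|y|<\eta_x$; then $\nabla\phi(x):=p_x$. For bounded $\phi\in C^{1,1}(x)$: if $\nabla\phi(x)\ne0$, with $\zeta=\nabla\phi(x)/|\nabla\phi(x)|$, $$\Delta^s_\infty\phi(x)=C_s\int_0^\infty(\phi(x+\eta\zeta)+\phi(x-\eta\zeta)-2\phi(x))\frac{d\eta}{\eta^{1+2s}};$$ if $\nabla\phi(x)=0$, $$\Delta^s_\infty\phi(x)=C_s\sup_{|y|=1}\int_0^\infty(\phi(x+\eta y)-\phi(x))\frac{d\eta}{\eta^{1+2s}}+C_s\inf_{|y|=1}\int_0^\infty(\phi(x-\eta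 y)-\phi(x))\frac{d\eta}{\eta^{1+2s}}.$$ The one-dimensional fractional Laplacian is $-(-\partial^2_{rr})^s\Phi(r)=C_s\int_0^\infty(\Phi(r+\eta)+\Phi(r-\eta)-2\Phi(r))\frac{d\eta}{\eta^{1+2s}}$. *)

theory Defs
  imports "HOL-Analysis.Analysis"
begin

definition C11_expansion :: "('a::euclidean_space \<Rightarrow> real) \<Rightarrow> 'a \<Rightarrow> 'a \<Rightarrow> bool" where
  "C11_expansion \<phi> x p \<longleftrightarrow>
     (\<exists>C>0. \<exists>\<eta>>0. \<forall>y. norm y < \<eta> \<longrightarrow> \<bar>\<phi> (x + y) - \<phi> x - p \<bullet> y\<bar> \<le> C * (norm y)\<^sup>2)"

definition C11_at :: "('a::euclidean_space \<Rightarrow> real) \<Rightarrow> 'a \<Rightarrow> bool" where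
  "C11_at \<phi> x \<longleftrightarrow> (\<exists>p. C11_expansion \<phi> x p)"

(* The vector p in the expansion is unique whenever it exists. *)
definition C11_grad :: "('a::euclidean_space \<Rightarrow> real) \<Rightarrow> 'a \<Rightarrow> 'a" where
  "C11_grad \<phi> x = (THE p. C11_expansion \<phi> x p)"

definition frac_const :: "real \<Rightarrow> real" where
  "frac_const s = 4 powr s * s * Gamma (1/2 + s) / (pi powr (1/2) * Gamma (1 - s))"

(* Meaningful only when phi is bounded and C11_at phi x: each integral below then has an
   absolutely convergent integrand (given measurability along lines), and the integrals in
   the case of vanishing gradient are bounded uniformly in the direction y, so the real
   SUP and INF are genuine. *)
definition inf_frac_laplacian ::
    "real \<Rightarrow> ('a::euclidean_space \<Rightarrow> real) \<Rightarrow> 'a \<Rightarrow> real" where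
  "inf_frac_laplacian s \<phi> x =
     (if C11_grad \<phi> x \<noteq> 0
      then let \<zeta> = C11_grad \<phi> x /\<^sub>R norm (C11_grad \<phi> x) in
        frac_const s *
          (LINT \<eta>:{0<..}|lebesgue.
             (\<phi> (x + \<eta> *\<^sub>R \<zeta>) + \<phi> (x - \<eta> *\<^sub>R \<zeta>) - 2 * \<phi> x) / \<eta> powr (1 + 2 * s))
      else
        frac_const s *
          (SUP y\<in>{y. norm y = 1}.
             LINT \<eta>:{0<..}|lebesgue. (\<phi> (x + \<eta> *\<^sub>R y) - \<phi> x) / \<eta> powr (1 + 2 * s))
        + frac_const s *
          (INF y\<in>{y. norm y = 1}.
             LINT \<eta>:{0<..}|lebesgue. (\<phi> (x - \<eta> *\<^sub>R y) - \<phi> x) / \<eta> powr (1 + 2 * s)))"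

(* This is -(-d^2/dr^2)^s, with the leading minus sign included. *)
definition neg_frac_laplacian_1d :: "real \<Rightarrow> (real \<Rightarrow> real) \<Rightarrow> real \<Rightarrow> real" where
  "neg_frac_laplacian_1d s \<Phi> r =
     frac_const s *
       (LINT \<eta>:{0<..}|lebesgue. (\<Phi> (r + \<eta>) + \<Phi> (r - \<eta>) - 2 * \<Phi> r) / \<eta> powr (1 + 2 * s))"

end

(* Along a line through x, the norm |x + \<eta> y| with |y| = 1 lies between | |x| - \<eta> | and |x| + \<eta>, with
   equality for y = -x/|x| and y = x/|x|. Reflecting in x shows that the gradient at x is a
   multiple of x, and by monotonicity a nonpositive one. So if it does not vanish then its direction is
   -x/|x|; if it vanishes then, by monotonicity again, -x/|x| is extremal for both the supremum
   and the infimum. In both cases the integrals are those of the profile. *)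
theory Submission
  imports Defs
begin

section \<open>Pointwise expansions with quadratic error and their gradient\<close>

lemma zero_if_linear_le_quadratic:
  fixes a :: real
  assumes "\<epsilon> > 0" and "\<And>t. \<lbrakk>0 < t; t < \<epsilon>\<rbrakk> \<Longrightarrow> t * a \<le> C * t\<^sup>2"
  shows "a \<le> 0"
proof (rule ccontr)
  assume "\<not> a \<le> 0"
  then have a: "a > 0" by simp
  \<comment> \<open>Dividing by \<open>t\<close> gives \<open>a \<le> C * t\<close>. The second
    entry makes the right side at most \<open>a / 2\<close>, and \<open>\<bar>C\<bar> + 1\<close>
    keeps the denominator positive whatever the sign of \<open>C\<close>.\<close>
  define t where "t = min (\<epsilon> / 2) (a / (2 * (\<bar>C\<bar> + 1)))"
  have t: "0 < t" "t < \<epsilon>" using assms(1) a by (auto simp: t_def)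
  have "t * a \<le> t * (C * t)" using assms(2)[OF t] by (simp add: power2_eq_square mult_ac)
  then have "a \<le> C * t" using t by simp
  also have "\<dots> \<le> (\<bar>C\<bar> + 1) * t" using t by (intro mult_right_mono) auto
  also have "\<dots> \<le> (\<bar>C\<bar> + 1) * (a / (2 * (\<bar>C\<bar> + 1)))" by (intro mult_left_mono) (auto simp: t_def)
  also have "\<dots> = a / 2" by (simp add: field_simps)
  finally show False using a by simp
qed

text \<open>Restriction to a line turns claims about \<open>p\<close> into scalar inequalities
  between a linear and a quadratic term in \<open>t\<close>.\<close>

lemma C11_expansion_along_line:
  assumes "C11_expansion \<phi> x p"
  obtains \<epsilon> C where "\<epsilon> > 0"
    "\<And>t. \<bar>t\<bar> < \<epsilon> \<Longrightarrow> \<bar>\<phi> (x + t *\<^sub>R v) - \<phi> x - t * (p \<bullet> v)\<bar> \<le> C * t\<^sup>2"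
proof -
  obtain C \<eta> where \<eta>: "\<eta> > 0"
    and *: "\<And>y. norm y < \<eta> \<Longrightarrow> \<bar>\<phi> (x + y) - \<phi> x - p \<bullet> y\<bar> \<le> C * (norm y)\<^sup>2"
    using assms unfolding C11_expansion_def by blast
  show ?thesis
  proof
    \<comment> \<open>The summand \<open>1\<close> makes the radius meaningful for
      \<open>v = 0\<close> as well.\<close>
    show "\<eta> / (norm v + 1) > 0" using \<eta> by (simp add: add_nonneg_pos)
    fix t :: real assume t: "\<bar>t\<bar> < \<eta> / (norm v + 1)"
    have "norm (t *\<^sub>R v) \<le> \<bar>t\<bar> * (norm v + 1)" by (simp add: mult_left_mono)
    also have "\<dots> < \<eta>" using t by (simp add: pos_less_divide_eq add_nonneg_pos)
    finally show "\<bar>\<phi> (x + t *\<^sub>R v) - \<phi> x - t * (p \<bullet> v)\<bar> \<le> (C * (norm v)\<^sup>2) * t\<^sup>2"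
      using *[of "t *\<^sub>R v"] by (simp add: power_mult_distrib mult_ac)
  qed
qed

text \<open>Along the direction \<open>p - q\<close> the difference of the two expansions has slope
  \<open>?v \<bullet> ?v\<close> and is bounded quadratically, so this slope vanishes. This
  justifies the definite description in \<open>C11_grad\<close>.\<close>

lemma C11_expansion_unique:
  assumes "C11_expansion \<phi> x p" "C11_expansion \<phi> x q"
  shows "p = q"
proof -
  let ?v = "p - q"
  obtain a A where a: "a > 0"
    and A: "\<And>t. \<bar>t\<bar> < a \<Longrightarrow> \<bar>\<phi> (x + t *\<^sub>R ?v) - \<phi> x - t * (p \<bullet> ?v)\<bar> \<le> A * t\<^sup>2"
    using C11_expansion_along_line[OF assms(1)] by blast
  obtain b B where b: "b > 0"
    and B: "\<And>t. \<bar>t\<bar> < b \<Longrightarrow> \<bar>\<phi> (x + t *\<^sub>R ?v) - \<phi> x - t * (q \<bullet> ?v)\<bar> \<le> B * t\<^sup>2"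
    using C11_expansion_along_line[OF assms(2)] by blast
  have "p \<bullet> ?v - q \<bullet> ?v \<le> 0"
  proof (rule zero_if_linear_le_quadratic)
    show "min a b > 0" using a b by simp
    show "t * (p \<bullet> ?v - q \<bullet> ?v) \<le> (A + B) * t\<^sup>2" if "0 < t" "t < min a b" for t
      using A[of t] B[of t] that unfolding distrib_right right_diff_distrib by linarith
  qed
  then have "?v \<bullet> ?v \<le> 0" by (simp add: inner_diff_left)
  then show ?thesis by (metis inner_gt_zero_iff not_less right_minus_eq)
qed

lemma C11_grad_expansion:
  assumes "C11_at \<phi> x"
  shows "C11_expansion \<phi> x (C11_grad \<phi> x)"
  using assms C11_expansion_unique unfolding C11_at_def C11_grad_def by (metis theI)

section \<open>Gradient of a radial, nonincreasing function\<close>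

lemma radial_C11_orthogonal:
  assumes "C11_expansion \<phi> x p" and radial: "\<And>z. \<phi> z = \<Phi>t (norm z)" and "x \<bullet> v = 0"
  shows "p \<bullet> v = 0"
proof -
  obtain \<epsilon> C where \<epsilon>: "\<epsilon> > 0"
    and C: "\<And>t. \<bar>t\<bar> < \<epsilon> \<Longrightarrow> \<bar>\<phi> (x + t *\<^sub>R v) - \<phi> x - t * (p \<bullet> v)\<bar> \<le> C * t\<^sup>2"
    using C11_expansion_along_line[OF assms(1)] by blast
  \<comment> \<open>Orthogonality gives both points the same norm, so \<open>\<phi>\<close> is even
    in \<open>t\<close> along this line. Comparing the expansions at \<open>t\<close> and
    \<open>- t\<close> isolates the odd term \<open>t * (p \<bullet> v)\<close>.\<close>
  have eq: "\<phi> (x + t *\<^sub>R v) = \<phi> (x + (- t) *\<^sub>R v)" for t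
    using assms(3) by (simp add: radial norm_eq_sqrt_inner inner_add inner_diff inner_commute)
  have "p \<bullet> v \<le> 0"
  proof (rule zero_if_linear_le_quadratic[OF \<epsilon>])
    show "t * (p \<bullet> v) \<le> C * t\<^sup>2" if "0 < t" "t < \<epsilon>" for t
      using C[of t] C[of "- t"] eq[of t] that by (simp add: abs_le_iff)
  qed
  moreover have "- (p \<bullet> v) \<le> 0"
  proof (rule zero_if_linear_le_quadratic[OF \<epsilon>])
    show "t * - (p \<bullet> v) \<le> C * t\<^sup>2" if "0 < t" "t < \<epsilon>" for t
      using C[of t] C[of "- t"] eq[of t] that by (simp add: abs_le_iff)
  qed
  ultimately show ?thesis by simp
qed

text \<open>The component of \<open>p\<close> orthogonal to \<open>x\<close> is orthogonal to
  \<open>p\<close> too, hence to itself. For \<open>x = 0\<close> the quotient is \<open>0\<close>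
  by convention, and the claim becomes \<open>p = 0\<close>.\<close>

lemma radial_C11_parallel:
  assumes "C11_expansion \<phi> x p" and "\<And>z. \<phi> z = \<Phi>t (norm z)"
  shows "p = (p \<bullet> x / (x \<bullet> x)) *\<^sub>R x"
proof -
  define w where "w = p - (p \<bullet> x / (x \<bullet> x)) *\<^sub>R x"
  have xw: "x \<bullet> w = 0"
    by (cases "x = 0") (simp_all add: w_def inner_diff_right inner_commute)
  then have "p \<bullet> w = 0" using radial_C11_orthogonal[OF assms] by blast
  then have "w \<bullet> w = 0" using xw by (simp add: w_def inner_diff_left)
  then show ?thesis by (simp add: w_def)
qed

text \<open>Moving from \<open>x\<close> towards the origin cannot decrease \<open>\<phi>\<close>,
  so the slope in direction \<open>-x\<close> is nonnegative.\<close>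

lemma radial_decreasing_C11_inner_le_0:
  assumes "C11_expansion \<phi> x p" and radial: "\<And>z. \<phi> z = \<Phi>t (norm z)"
    and "antimono_on {0..} \<Phi>t"
  shows "p \<bullet> x \<le> 0"
proof -
  obtain \<epsilon> C where \<epsilon>: "\<epsilon> > 0"
    and C: "\<And>t. \<bar>t\<bar> < \<epsilon> \<Longrightarrow> \<bar>\<phi> (x + t *\<^sub>R (-x)) - \<phi> x - t * (p \<bullet> (-x))\<bar> \<le> C * t\<^sup>2"
    using C11_expansion_along_line[OF assms(1)] by blast
  show ?thesis
  proof (rule zero_if_linear_le_quadratic)
    \<comment> \<open>The cap \<open>1\<close> stops the movement before it passes the
      origin.\<close>
    show "min \<epsilon> 1 > 0" using \<epsilon> by simp
    fix t :: real assume t: "0 < t" "t < min \<epsilon> 1"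
    have "x + t *\<^sub>R (-x) = (1 - t) *\<^sub>R x" by (simp add: algebra_simps)
    then have "norm (x + t *\<^sub>R (-x)) = (1 - t) * norm x" using t by simp
    also have "\<dots> \<le> norm x" using t by (simp add: mult_left_le_one_le)
    finally have "\<phi> x \<le> \<phi> (x + t *\<^sub>R (-x))"
      using assms(3) unfolding radial monotone_on_def by auto
    then show "t * (p \<bullet> x) \<le> C * t\<^sup>2" using C[of t] t by simp
  qed
qed

section \<open>Convergence of the singular integrals\<close>

lemma set_integrable_div_powr:
  fixes g :: "real \<Rightarrow> real"
  assumes g: "g \<in> borel_measurable borel" and s: "0 < s" "s < 1"
    and B: "\<And>t. \<bar>g t\<bar> \<le> B"
    and \<epsilon>: "\<epsilon> > 0" and C: "\<And>t. \<lbrakk>0 < t; t < \<epsilon>\<rbrakk> \<Longrightarrow> \<bar>g t\<bar> \<le> C * t\<^sup>2"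
  shows "set_integrable lebesgue {0<..} (\<lambda>t. g t / t powr (1 + 2 * s))"
proof -
  let ?f = "\<lambda>t. g t / t powr (1 + 2 * s)"
  \<comment> \<open>Strictly below \<open>\<epsilon>\<close>, so that the quadratic bound also
    covers the closed endpoint \<open>d\<close>.\<close>
  define d where "d = \<epsilon> / 2"
  have d: "d > 0" "d < \<epsilon>" using \<epsilon> by (auto simp: d_def)
  have mf: "?f \<in> borel_measurable (lebesgue_on S)" if "S \<in> sets lebesgue" for S
  proof -
    have "?f \<in> borel_measurable borel" using g by measurable
    then have "?f \<in> borel_measurable lebesgue" by (simp add: measurable_completion)
    then show ?thesis by (simp add: measurable_restrict_space1)
  qed
  \<comment> \<open>Near zero the quadratic bound leaves the exponent \<open>1 - 2 * s\<close>,
    which exceeds \<open>-1\<close> because \<open>s < 1\<close>.\<close>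
  have "?f absolutely_integrable_on {0<..d}"
  proof (rule measurable_bounded_by_integrable_imp_absolutely_integrable[OF mf])
    have "(\<lambda>t. C * t powr (1 - 2 * s)) integrable_on {0..d}"
      using integrable_on_powr_from_0[of "1 - 2 * s" d] s d
      by (intro integrable_on_mult_right) simp_all
    then show "(\<lambda>t. C * t powr (1 - 2 * s)) integrable_on {0<..d}"
      by (rule integrable_spike_set) (auto intro: negligible_subset[of "{0}"])
    fix t :: real assume t: "t \<in> {0<..d}"
    have "t\<^sup>2 = t powr (1 - 2 * s) * t powr (1 + 2 * s)"
      using t by (simp flip: powr_add)
    then show "norm (?f t) \<le> C * t powr (1 - 2 * s)"
      using C[of t] t d by (simp add: pos_divide_le_eq mult_ac)
  qed (auto intro: sets_completionI_sets)
  \<comment> \<open>In the tail, boundedness leaves the exponent \<open>- 1 - 2 * s\<close>, which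
    is below \<open>-1\<close> because \<open>s > 0\<close>.\<close>
  moreover have "?f absolutely_integrable_on {d..}"
  proof (rule measurable_bounded_by_integrable_imp_absolutely_integrable[OF mf])
    show "(\<lambda>t. B * t powr (- 1 - 2 * s)) integrable_on {d..}"
      using has_integral_powr_to_inf[of "- 1 - 2 * s" d] s d
      by (intro integrable_on_mult_right) (auto simp: integrable_on_def)
    fix t :: real assume t: "t \<in> {d..}"
    have "t powr (- 1 - 2 * s) * t powr (1 + 2 * s) = 1"
      using t d by (simp flip: powr_add)
    then show "norm (?f t) \<le> B * t powr (- 1 - 2 * s)"
      using B[of t] t d by (simp add: pos_divide_le_eq mult.assoc)
  qed (auto intro: sets_completionI_sets)
  moreover have "{0<..} = {0<..d} \<union> {d..}" using d by auto
  ultimately show ?thesis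
    using set_integrable_Un[of lebesgue "{0<..d}" ?f "{d..}"] by (simp add: sets_completionI_sets del: sets_completion)
qed

text \<open>Measurability comes from monotonicity: \<open>max 0\<close> extends the profile to a
  monotone function on the whole line, and \<open>norm\<close> is Borel.\<close>

lemma borel_measurable_radial_decreasing:
  fixes \<phi> :: "'a::euclidean_space \<Rightarrow> real"
  assumes radial: "\<And>z. \<phi> z = \<Phi>t (norm z)" and anti: "antimono_on {0..} \<Phi>t"
  shows "\<phi> \<in> borel_measurable borel"
proof -
  have "mono (\<lambda>r. - \<Phi>t (max 0 r))"
    using anti by (auto simp: monotone_on_def)
  then have "(\<lambda>r. - (- \<Phi>t (max 0 r))) \<in> borel_measurable borel"
    by (intro borel_measurable_uminus borel_measurable_mono)
  then have "(\<lambda>z::'a. - (- \<Phi>t (max 0 (norm z)))) \<in> borel_measurable borel"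
    by (rule measurable_compose[rotated]) simp
  then show ?thesis by (simp add: radial[abs_def])
qed

text \<open>With zero gradient the one-sided difference is already quadratic near \<open>x\<close>,
  so each one-sided integral converges by itself. These integrals are then compared and added in the
  degenerate case.\<close>

lemma radial_difference_quotient_integrable:
  fixes \<phi> :: "'a::euclidean_space \<Rightarrow> real"
  assumes radial: "\<And>z. \<phi> z = \<Phi>t (norm z)" and "antimono_on {0..} \<Phi>t"
    and bdd: "bounded (range \<phi>)" and exp: "C11_expansion \<phi> x 0" and s: "0 < s" "s < 1"
  shows "set_integrable lebesgue {0<..} (\<lambda>\<eta>. (\<phi> (x + \<eta> *\<^sub>R y) - \<phi> x) / \<eta> powr (1 + 2 * s))"
proof -
  obtain M where M: "\<And>z. \<bar>\<phi> z\<bar> \<le> M" using bdd by (auto simp: bounded_iff)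
  obtain \<epsilon> C where \<epsilon>: "\<epsilon> > 0"
    and C: "\<And>t. \<bar>t\<bar> < \<epsilon> \<Longrightarrow> \<bar>\<phi> (x + t *\<^sub>R y) - \<phi> x - t * (0 \<bullet> y)\<bar> \<le> C * t\<^sup>2"
    using C11_expansion_along_line[OF exp] by blast
  note [measurable] = borel_measurable_radial_decreasing[OF assms(1,2)]
  show ?thesis
  proof (rule set_integrable_div_powr[OF _ s _ \<epsilon>])
    show "(\<lambda>\<eta>. \<phi> (x + \<eta> *\<^sub>R y) - \<phi> x) \<in> borel_measurable borel" by measurable
    show "\<bar>\<phi> (x + t *\<^sub>R y) - \<phi> x\<bar> \<le> 2 * M" for t
      using M[of "x + t *\<^sub>R y"] M[of x] by linarith
    show "\<bar>\<phi> (x + t *\<^sub>R y) - \<phi> x\<bar> \<le> C * t\<^sup>2" if "0 < t" "t < \<epsilon>" for t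
      using C[of t] that by simp
  qed
qed

section \<open>Attained extrema and the two cases of the gradient\<close>

lemma cSUP_eq_attained:
  fixes f :: "'a \<Rightarrow> 'b::conditionally_complete_lattice"
  assumes "a \<in> A" and "\<And>y. y \<in> A \<Longrightarrow> f y \<le> f a"
  shows "(SUP y\<in>A. f y) = f a"
  using assms by (intro cSup_eq_maximum) auto

lemma cINF_eq_attained:
  fixes f :: "'a \<Rightarrow> 'b::conditionally_complete_lattice"
  assumes "a \<in> A" and "\<And>y. y \<in> A \<Longrightarrow> f a \<le> f y"
  shows "(INF y\<in>A. f y) = f a"
  using assms by (intro cInf_eq_minimum) auto

theorem proposition6p1:
  fixes s :: real
    and x :: "real ^ 'n"
    and \<phi> :: "real ^ 'n \<Rightarrow> real"
    and \<Phi>t \<Phi> :: "real \<Rightarrow> real"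
  assumes "CARD('n) \<ge> 2"
    and "1/2 < s" and "s < 1"
    and "bounded (range \<phi>)"
    and "C11_at \<phi> x"
    and "\<And>z. \<phi> z = \<Phi>t (norm z)"
    and "antimono_on {0..} \<Phi>t"
    and "\<And>r. r \<ge> 0 \<Longrightarrow> \<Phi> r = \<Phi>t r"
    and "\<And>r. r \<ge> 0 \<Longrightarrow> \<Phi> (- r) = \<Phi> r"
  shows "inf_frac_laplacian s \<phi> x = neg_frac_laplacian_1d s \<Phi> (norm x)"
proof -
  define p where "p = C11_grad \<phi> x"
  have p: "C11_expansion \<phi> x p"
    unfolding p_def by (rule C11_grad_expansion[OF assms(5)])
  have \<Phi>: "\<Phi> r = \<Phi>t \<bar>r\<bar>" for r
    using assms(8)[of "\<bar>r\<bar>"] assms(9)[of "\<bar>r\<bar>"] by (cases "r \<ge> 0") simp_all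
  have anti: "\<Phi>t b \<le> \<Phi>t a" if "0 \<le> a" "a \<le> b" for a b
    using assms(7) that by (simp add: monotone_on_def)
  (* The inward unit vector at x, or an arbitrary unit vector if x = 0. *)
  obtain u :: "real ^ 'n" where u: "norm u = 1" and xu: "x = (- norm x) *\<^sub>R u"
  proof (cases "x = 0")
    case True
    then show ?thesis using that[of "axis undefined 1"] by simp
  next
    case False
    then show ?thesis using that[of "- (x /\<^sub>R norm x)"] by simp
  qed
  \<comment> \<open>This holds for every real \<open>\<eta>\<close>: evenness of
    \<open>\<Phi>\<close> covers the passage through the origin, and negative \<open>\<eta>\<close>
    gives the outward formula.\<close>
  have in_u: "\<phi> (x + \<eta> *\<^sub>R u) = \<Phi> (norm x - \<eta>)" for \<eta>
  proof -
    have "x + \<eta> *\<^sub>R u = (\<eta> - norm x) *\<^sub>R u"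
      by (subst xu) (simp add: algebra_simps)
    then show ?thesis using u by (simp add: assms(6) \<Phi> abs_minus_commute)
  qed
  have out_u: "\<phi> (x - \<eta> *\<^sub>R u) = \<Phi> (norm x + \<eta>)" for \<eta>
    using in_u[of "- \<eta>"] by simp
  have x0: "\<phi> x = \<Phi> (norm x)"
    by (simp add: assms(6) \<Phi>)
  show ?thesis
  proof (cases "p = 0")
    case False
    define c where "c = p \<bullet> x / (x \<bullet> x)"
    have px: "p = c *\<^sub>R x"
      unfolding c_def by (rule radial_C11_parallel[OF p assms(6)])
    have "c \<le> 0"
      unfolding c_def using radial_decreasing_C11_inner_le_0[OF p assms(6,7)]
      by (simp add: divide_nonpos_nonneg)
    moreover have "c \<noteq> 0" "x \<noteq> 0" using False px by auto
    ultimately have c: "c < 0" by simp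
    \<comment> \<open>The factor \<open>- c * norm x\<close> is positive and equals
      \<open>norm p\<close>, so normalizing leaves \<open>u\<close>.\<close>
    have "p /\<^sub>R norm p = (- c * norm x) *\<^sub>R u /\<^sub>R (- c * norm x)"
      using c by (subst (1) px, subst (1) xu) (simp add: px)
    also have "\<dots> = u" using c \<open>x \<noteq> 0\<close> by (simp add: field_simps)
    finally have "C11_grad \<phi> x /\<^sub>R norm (C11_grad \<phi> x) = u" by (simp add: p_def)
    then show ?thesis
      using False
      by (simp add: inf_frac_laplacian_def neg_frac_laplacian_1d_def p_def Let_def
          in_u out_u x0 add.commute)
  next
    case True
    let ?I = "\<lambda>y. LINT \<eta>:{0<..}|lebesgue. (\<phi> (x + \<eta> *\<^sub>R y) - \<phi> x) / \<eta> powr (1 + 2 * s)"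
    let ?J = "\<lambda>y. LINT \<eta>:{0<..}|lebesgue. (\<phi> (x - \<eta> *\<^sub>R y) - \<phi> x) / \<eta> powr (1 + 2 * s)"
    have int: "set_integrable lebesgue {0<..}
        (\<lambda>\<eta>. (\<phi> (x + \<eta> *\<^sub>R y) - \<phi> x) / \<eta> powr (1 + 2 * s))" for y
      using radial_difference_quotient_integrable[OF assms(6,7,4)] p True assms(2,3) by auto
    have int': "set_integrable lebesgue {0<..}
        (\<lambda>\<eta>. (\<phi> (x - \<eta> *\<^sub>R y) - \<phi> x) / \<eta> powr (1 + 2 * s))" for y
      using int[of "- y"] by simp
    have S: "(SUP y\<in>{y. norm y = 1}. ?I y) = ?I u"
    proof (rule cSUP_eq_attained)
      fix y :: "real ^ 'n" assume y: "y \<in> {y. norm y = 1}"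
      show "?I y \<le> ?I u"
      proof (rule set_integral_mono[OF int int])
        fix \<eta> :: real assume \<eta>: "\<eta> \<in> {0<..}"
        \<comment> \<open>At each distance \<open>\<eta>\<close> from \<open>x\<close>, the
          direction \<open>u\<close> comes closest to the origin. It thus maximizes the integrand
          for all \<open>\<eta>\<close> simultaneously.\<close>
        have "\<bar>norm x - \<eta>\<bar> \<le> norm (x + \<eta> *\<^sub>R y)"
          using norm_triangle_ineq3[of x "- (\<eta> *\<^sub>R y)"] y \<eta> by simp
        then have "\<phi> (x + \<eta> *\<^sub>R y) \<le> \<phi> (x + \<eta> *\<^sub>R u)"
          unfolding in_u \<Phi> by (simp add: assms(6) anti)
        then show "(\<phi> (x + \<eta> *\<^sub>R y) - \<phi> x) / \<eta> powr (1 + 2 * s)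
            \<le> (\<phi> (x + \<eta> *\<^sub>R u) - \<phi> x) / \<eta> powr (1 + 2 * s)"
          by (simp add: divide_right_mono)
      qed
    qed (simp add: u)
    \<comment> \<open>The infimum is taken over displacements \<open>- \<eta> *\<^sub>R y\<close>,
      so the same \<open>u\<close> now leads outward to the farthest point, where
      \<open>\<phi>\<close> is smallest.\<close>
    have J: "(INF y\<in>{y. norm y = 1}. ?J y) = ?J u"
    proof (rule cINF_eq_attained)
      fix y :: "real ^ 'n" assume y: "y \<in> {y. norm y = 1}"
      show "?J u \<le> ?J y"
      proof (rule set_integral_mono[OF int' int'])
        fix \<eta> :: real assume \<eta>: "\<eta> \<in> {0<..}"
        have "norm (x - \<eta> *\<^sub>R y) \<le> \<bar>norm x + \<eta>\<bar>"
          using norm_triangle_ineq4[of x "\<eta> *\<^sub>R y"] y \<eta> by simp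
        then have "\<phi> (x - \<eta> *\<^sub>R u) \<le> \<phi> (x - \<eta> *\<^sub>R y)"
          unfolding out_u \<Phi> by (simp add: assms(6) anti)
        then show "(\<phi> (x - \<eta> *\<^sub>R u) - \<phi> x) / \<eta> powr (1 + 2 * s)
            \<le> (\<phi> (x - \<eta> *\<^sub>R y) - \<phi> x) / \<eta> powr (1 + 2 * s)"
          by (simp add: divide_right_mono)
      qed
    qed (simp add: u)
    have "inf_frac_laplacian s \<phi> x = frac_const s * (?I u + ?J u)"
      using True by (simp only: inf_frac_laplacian_def p_def S J distrib_left) simp
    \<comment> \<open>Both integrals converge separately, so their sum is the integral of the
      symmetric second difference of \<open>\<Phi>\<close> at \<open>norm x\<close>.\<close>
    also have "?I u + ?J u = (LINT \<eta>:{0<..}|lebesgue.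
        (\<phi> (x + \<eta> *\<^sub>R u) - \<phi> x) / \<eta> powr (1 + 2 * s)
        + (\<phi> (x - \<eta> *\<^sub>R u) - \<phi> x) / \<eta> powr (1 + 2 * s))"
      by (rule set_integral_add(2)[OF int int', symmetric])
    also have "frac_const s * \<dots> = neg_frac_laplacian_1d s \<Phi> (norm x)"
      unfolding neg_frac_laplacian_1d_def in_u out_u x0
      by (simp add: algebra_simps flip: add_divide_distrib)
    finally show ?thesis .
  qed
qed

end
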